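(* (a) Let $R$ be an integral domain with quotient field $K$. Suppose that for each $0\neq r\in R$ the ring $R/(r)$ is finite. Then the composite cover of $I(K,R)$ is $R+XK[X]$. (b) Let $A\subseteq B$ be rings where $A$ is finite. Then the composite cover of $I(B,A)$ is $A+XB[X]$.
   Context: All rings are commutative with unity. For rings $A\subseteq B$, $I(B,A)=\{f(X)\in B[X]\mid f(A)\subseteq A\}$, and $A+XB[X]$ is the subring of $B[X]$ of polynomials with constant term in $A$. A composite (inside $B[X]$) is a ring of the form $C+XE[X]$ with $C\subseteq E$ subrings of $B$. For a ring $R'$ with $A[X]\subseteq R'\subseteq B[X]$, the composite cover of $R'$ is the unique minimal overring of $R'$ (inside $B[X]$) that is a composite. In (a) this is applied with $A=R$ and $B=K$. *)

theory Defs
  imports "HOL-Algebra.Subrings" "HOL-Algebra.QuotRing" "HOL-Algebra.UnivPoly"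
begin

text \<open>
  Rings are HOL-Algebra structures, so the zero ring is included. An extension \<open>A \<subseteq> B\<close> is a
  ring \<open>B\<close> together with a subset \<open>A\<close> of its carrier satisfying \<^const>\<open>subring\<close> (in particular
  \<open>A\<close> contains the unit of \<open>B\<close>). The ring \<open>B[X]\<close> is \<open>UP B\<close>.
\<close>

definition is_quotient_field :: "'a set \<Rightarrow> ('a, 'm) ring_scheme \<Rightarrow> bool" where
  "is_quotient_field R K \<longleftrightarrow> field K \<and> subdomain R K \<and>
     (\<forall>x\<in>carrier K. \<exists>a\<in>R. \<exists>b\<in>R - {\<zero>\<^bsub>K\<^esub>}. x = a \<otimes>\<^bsub>K\<^esub> inv\<^bsub>K\<^esub> b)"

text \<open>The third argument of \<^const>\<open>eval\<close> is the map applied to the coefficients.\<close>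

definition int_valued_polys :: "('a, 'm) ring_scheme \<Rightarrow> 'a set \<Rightarrow> (nat \<Rightarrow> 'a) set" where
  "int_valued_polys B A = {f \<in> carrier (UP B). \<forall>a\<in>A. eval B B (\<lambda>x. x) a f \<in> A}"

text \<open>\<open>C + X E[X]\<close>\<close>

definition composite_ring :: "('a, 'm) ring_scheme \<Rightarrow> 'a set \<Rightarrow> 'a set \<Rightarrow> (nat \<Rightarrow> 'a) set" where
  "composite_ring B C E =
     {f \<in> carrier (UP B). coeff (UP B) f 0 \<in> C \<and> (\<forall>n>0. coeff (UP B) f n \<in> E)}"

definition is_composite :: "('a, 'm) ring_scheme \<Rightarrow> (nat \<Rightarrow> 'a) set \<Rightarrow> bool" where
  "is_composite B T \<longleftrightarrow>
     (\<exists>C E. subring C B \<and> subring E B \<and> C \<subseteq> E \<and> T = composite_ring B C E)"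

definition is_minimal_composite_overring ::
    "('a, 'm) ring_scheme \<Rightarrow> (nat \<Rightarrow> 'a) set \<Rightarrow> (nat \<Rightarrow> 'a) set \<Rightarrow> bool" where
  "is_minimal_composite_overring B S T \<longleftrightarrow> is_composite B T \<and> S \<subseteq> T \<and>
     (\<forall>T'. is_composite B T' \<and> S \<subseteq> T' \<and> T' \<subseteq> T \<longrightarrow> T' = T)"

definition is_composite_cover ::
    "('a, 'm) ring_scheme \<Rightarrow> (nat \<Rightarrow> 'a) set \<Rightarrow> (nat \<Rightarrow> 'a) set \<Rightarrow> bool" where
  "is_composite_cover B S T \<longleftrightarrow> is_minimal_composite_overring B S T \<and>
     (\<forall>T'. is_minimal_composite_overring B S T' \<longrightarrow> T' = T)"

end

theory Submission
  imports Defs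
begin

text \<open>
  A composite \<open>C + X E[X]\<close> containing \<open>I(B,A)\<close> contains the constants in \<open>A\<close>, so \<open>A \<subseteq> C\<close>, and it
  remains to see that every \<open>b \<in> B\<close> is a coefficient of positive index of some integer-valued
  polynomial, so that \<open>E = B\<close>. Such a polynomial is \<open>b \<Prod>r\<in>F. (X - r)\<close>, where \<open>F = A\<close> if \<open>A\<close> is
  finite, while for \<open>b = x / d\<close> in a quotient field \<open>F\<close> is a set of representatives of \<open>R / (d)\<close>:
  one factor \<open>a - r\<close> is then a multiple of \<open>d\<close>.
\<close>

context UP_cring
begin

lemma UP_pre_univ_prop_id: "UP_pre_univ_prop R R (\<lambda>x. x)"
  by (intro UP_pre_univ_propI R.is_cring) (auto simp: ring_hom_def)

text \<open>Interpreting \<^locale>\<open>UP_pre_univ_prop\<close> at the identity would make its homomorphism simp rules loop.\<close>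

lemmas eval_id_hom = UP_pre_univ_prop.eval_ring_hom[OF UP_pre_univ_prop_id, folded P_def]
lemmas eval_id_const = UP_pre_univ_prop.eval_const[OF UP_pre_univ_prop_id, folded P_def]
lemmas eval_id_monom1 = UP_pre_univ_prop.eval_monom1[OF UP_pre_univ_prop_id, folded P_def]

text \<open>Every term of positive degree vanishes at zero. As \<open>\<zero>\<close> lies in
  \<open>A\<close>, this puts the constant term of an integer-valued polynomial into
  \<open>A\<close>.\<close>

lemma eval_id_zero:
  assumes p: "p \<in> carrier P"
  shows "eval R R (\<lambda>x. x) \<zero> p = coeff P p 0"
proof -
  have "eval R R (\<lambda>x. x) \<zero> p = (\<Oplus>i\<in>{..deg R p}. coeff P p i \<otimes> \<zero> [^] i)"
    using p by (simp add: eval_on_carrier)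
  also have "\<dots> = (\<Oplus>i\<in>{..deg R p}. if 0 = i then coeff P p i else \<zero>)"
    using p by (intro R.finsum_cong') (auto simp: R.nat_pow_zero)
  also have "\<dots> = coeff P p 0"
    using p by (intro R.finsum_singleton) auto
  finally show ?thesis .
qed

text \<open>The product b \<Prod>r\<in>F. (X - r) is built one factor at a time. The value at a is b
  times all the a - r, and the product of any subfamily of these factors lies in \<open>A\<close>,
  which supplies the cofactor \<open>c\<close>. The vanishing of the coefficients above
  \<open>card F\<close> makes b the leading coefficient at each step of the induction, without any
  appeal to the degree.\<close>

lemma exists_poly_with_roots:
  assumes A: "subring A R" and F: "finite F" "F \<subseteq> A" and b: "b \<in> carrier R"
  shows "\<exists>p\<in>carrier P. coeff P p (card F) = b \<and> (\<forall>n>card F. coeff P p n = \<zero>) \<and>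
           (\<forall>a\<in>A. (\<exists>c\<in>A. eval R R (\<lambda>x. x) a p = b \<otimes> c) \<and>
              (\<forall>r\<in>F. \<exists>c\<in>A. eval R R (\<lambda>x. x) a p = b \<otimes> ((a \<ominus> r) \<otimes> c)))"
  using F
proof (induction F)
  case empty
  show ?case
  proof (intro bexI[of _ "monom P b 0"] conjI ballI allI impI)
    fix a assume a: "a \<in> A"
    then have "eval R R (\<lambda>x. x) a (monom P b 0) = b \<otimes> \<one>"
      using b subringE(1)[OF A] by (subst eval_id_const) auto
    then show "\<exists>c\<in>A. eval R R (\<lambda>x. x) a (monom P b 0) = b \<otimes> c"
      using subringE(3)[OF A] by blast
  qed (use b in auto)
next
  case (insert r F)
  from insert obtain p where p: "p \<in> carrier P" "coeff P p (card F) = b"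
    and high: "\<And>n. n > card F \<Longrightarrow> coeff P p n = \<zero>"
    and val: "\<And>a. a \<in> A \<Longrightarrow> \<exists>c\<in>A. eval R R (\<lambda>x. x) a p = b \<otimes> c"
    and root: "\<And>a s. \<lbrakk>a \<in> A; s \<in> F\<rbrakk> \<Longrightarrow> \<exists>c\<in>A. eval R R (\<lambda>x. x) a p = b \<otimes> ((a \<ominus> s) \<otimes> c)"
    by auto
  note A_carr = subsetD[OF subringE(1)[OF A]]
  have rA: "r \<in> A" and r: "r \<in> carrier R"
    using insert.prems A_carr by auto
  \<comment> \<open>This is (X - r) p, expanded so that each summand is a monomial times
    \<open>p\<close>.\<close>
  define q where "q = monom P \<one> 1 \<otimes>\<^bsub>P\<^esub> p \<ominus>\<^bsub>P\<^esub> monom P r 0 \<otimes>\<^bsub>P\<^esub> p"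
  have q: "q \<in> carrier P"
    using p r by (simp add: q_def)
  have coeff_q: "coeff P q (Suc n) = coeff P p n \<ominus> r \<otimes> coeff P p (Suc n)" for n
  proof -
    have "coeff P (monom P \<one> 1 \<otimes>\<^bsub>P\<^esub> p) (n + 1) = coeff P p n"
      using coeff_monom_mult[of \<one> p 1 n] p by simp
    moreover have "coeff P (monom P r 0 \<otimes>\<^bsub>P\<^esub> p) (Suc n + 0) = r \<otimes> coeff P p (Suc n)"
      using coeff_monom_mult[of r p 0 "Suc n"] p r by simp
    ultimately show ?thesis
      using p r unfolding q_def by (subst coeff_minus) simp_all
  qed
  have eval_q: "eval R R (\<lambda>x. x) a q = (a \<ominus> r) \<otimes> eval R R (\<lambda>x. x) a p" if a: "a \<in> A" for a
  proof -
    have a: "a \<in> carrier R" using a A_carr by blast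
    interpret ev: ring_hom_cring P R "eval R R (\<lambda>x. x) a"
      by unfold_locales (rule eval_id_hom[OF a])
    have "eval R R (\<lambda>x. x) a q = a \<otimes> eval R R (\<lambda>x. x) a p \<ominus> r \<otimes> eval R R (\<lambda>x. x) a p"
      using a r p eval_id_monom1[OF a] eval_id_const[OF a r] unfolding q_def
      by (simp add: R.minus_eq P.minus_eq)
    also have "\<dots> = (a \<ominus> r) \<otimes> eval R R (\<lambda>x. x) a p"
      using a r p(1) ev.hom_closed[OF p(1)] by (simp add: R.minus_eq R.l_distr R.l_minus)
    finally show ?thesis .
  qed
  have card: "card (insert r F) = Suc (card F)"
    using insert.hyps by simp
  show ?case unfolding card
  proof (intro bexI[OF _ q] conjI ballI allI impI)
    \<comment> \<open>The recursion gives b minus r times the coefficient of \<open>p\<close> at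
      \<open>Suc (card F)\<close>, and the latter is zero by \<open>high\<close>.\<close>
    show "coeff P q (Suc (card F)) = b"
      using b r p high by (simp add: coeff_q R.minus_eq)
  next
    fix n assume "n > Suc (card F)"
    then show "coeff P q n = \<zero>"
      using r high by (cases n) (auto simp: coeff_q R.minus_eq)
  next
    fix a assume a: "a \<in> A"
    have arA: "a \<ominus> r \<in> A"
      using a rA subringE(5,7)[OF A] by (simp add: R.minus_eq)
    obtain c where c: "c \<in> A" "eval R R (\<lambda>x. x) a p = b \<otimes> c"
      using val a by blast
    have eq: "eval R R (\<lambda>x. x) a q = b \<otimes> ((a \<ominus> r) \<otimes> c)"
      using a arA b c A_carr by (simp add: eval_q R.m_lcomm)
    then show "\<exists>c\<in>A. eval R R (\<lambda>x. x) a q = b \<otimes> c"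
      using arA c subringE(6)[OF A] by blast
    fix s assume s: "s \<in> insert r F"
    show "\<exists>c\<in>A. eval R R (\<lambda>x. x) a q = b \<otimes> ((a \<ominus> s) \<otimes> c)"
    proof (cases "s = r")
      case True
      then show ?thesis using eq c by blast
    next
      case False
      with s have sF: "s \<in> F" by simp
      then obtain c where c: "c \<in> A" "eval R R (\<lambda>x. x) a p = b \<otimes> ((a \<ominus> s) \<otimes> c)"
        using root a by blast
      have "s \<in> carrier R"
        using sF insert.prems A_carr by blast
      \<comment> \<open>The new factor a - r is moved past a - s and absorbed into the
        cofactor.\<close>
      then have "eval R R (\<lambda>x. x) a q = b \<otimes> ((a \<ominus> s) \<otimes> ((a \<ominus> r) \<otimes> c))"
        using a arA b c A_carr by (simp add: eval_q R.m_lcomm)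
      then show ?thesis
        using arA c subringE(6)[OF A] by blast
    qed
  qed
qed

end

text \<open>The candidate is shown to be the least composite containing
  \<open>int_valued_polys B A\<close>, not merely a minimal one, so minimality and uniqueness follow
  together.\<close>

lemma composite_cover_int_valued_polys:
  assumes B: "cring B" and A: "subring A B"
    and witness: "\<And>b. b \<in> carrier B \<Longrightarrow>
      \<exists>p\<in>int_valued_polys B A. \<exists>n>0. coeff (UP B) p n = b"
  shows "is_composite_cover B (int_valued_polys B A) (composite_ring B A (carrier B))"
proof -
  interpret UP_cring B "UP B"
    using B by (simp add: UP_cring_def)
  let ?S = "int_valued_polys B A" and ?T = "composite_ring B A (carrier B)"
  note A_carr = subsetD[OF subringE(1)[OF A]]
  have composite: "is_composite B ?T"
    unfolding is_composite_def using A R.carrier_is_subring subringE(1)[OF A] by blast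
  have S_le: "?S \<subseteq> ?T"
  proof
    fix f assume f: "f \<in> ?S"
    then have "f \<in> carrier (UP B)" "eval B B (\<lambda>x. x) \<zero>\<^bsub>B\<^esub> f \<in> A"
      using subringE(2)[OF A] by (auto simp: int_valued_polys_def)
    then show "f \<in> ?T"
      by (simp add: eval_id_zero composite_ring_def)
  qed
  have least: "?T \<subseteq> T'" if T': "is_composite B T'" "?S \<subseteq> T'" for T'
  proof -
    obtain C E where CE: "subring C B" "subring E B" "T' = composite_ring B C E"
      using T'(1) unfolding is_composite_def by blast
    have "A \<subseteq> C"
    proof
      fix c assume c: "c \<in> A"
      \<comment> \<open>A constant from \<open>A\<close> takes only that value, hence is
        integer-valued.\<close>
      then have "monom (UP B) c 0 \<in> ?S"
        using A_carr by (auto simp: int_valued_polys_def eval_id_const)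
      then have "monom (UP B) c 0 \<in> composite_ring B C E"
        using T'(2) CE(3) by blast
      then show "c \<in> C"
        using c A_carr by (simp add: composite_ring_def)
    qed
    moreover have "carrier B \<subseteq> E"
      using witness T'(2) CE(3) unfolding composite_ring_def by blast
    ultimately show ?thesis
      unfolding CE(3) composite_ring_def by blast
  qed
  show ?thesis
    unfolding is_composite_cover_def is_minimal_composite_overring_def
    using composite S_le least by blast
qed

text \<open>The common form of both cases: \<open>absorb\<close> asks that for each a some single
  factor a - r already carries b times any multiple from \<open>A\<close> back into
  \<open>A\<close>, so the other factors do no harm.\<close>

lemma exists_int_valued_poly:
  assumes B: "cring B" and A: "subring A B" and F: "finite F" "F \<subseteq> A" and b: "b \<in> carrier B"
    and absorb: "\<And>a. a \<in> A \<Longrightarrow> \<exists>r\<in>F. \<forall>c\<in>A. b \<otimes>\<^bsub>B\<^esub> ((a \<ominus>\<^bsub>B\<^esub> r) \<otimes>\<^bsub>B\<^esub> c) \<in> A"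
  shows "\<exists>p\<in>int_valued_polys B A. \<exists>n>0. coeff (UP B) p n = b"
proof -
  interpret UP_cring B "UP B"
    using B by (simp add: UP_cring_def)
  \<comment> \<open>Applying \<open>absorb\<close> to zero yields an element of \<open>F\<close>.
    This keeps the index \<open>card F\<close> positive, away from the constant term.\<close>
  have "F \<noteq> {}"
    using absorb subringE(2)[OF A] by blast
  then have card: "card F > 0"
    using F by (simp add: card_gt_0_iff)
  obtain p where p: "p \<in> carrier (UP B)" "coeff (UP B) p (card F) = b"
    and val: "\<And>a r. \<lbrakk>a \<in> A; r \<in> F\<rbrakk> \<Longrightarrow>
      \<exists>c\<in>A. eval B B (\<lambda>x. x) a p = b \<otimes>\<^bsub>B\<^esub> ((a \<ominus>\<^bsub>B\<^esub> r) \<otimes>\<^bsub>B\<^esub> c)"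
    using exists_poly_with_roots[OF A F b] by blast
  have "eval B B (\<lambda>x. x) a p \<in> A" if "a \<in> A" for a
    using absorb[OF that] val[OF that] by fastforce
  then have "p \<in> int_valued_polys B A"
    using p by (simp add: int_valued_polys_def)
  then show ?thesis
    using p card by blast
qed

lemma finite_quotient_representatives:
  assumes K: "cring K" and R: "subring R K"
    and fin: "finite (carrier (K\<lparr>carrier := R\<rparr> Quot (PIdl\<^bsub>K\<lparr>carrier := R\<rparr>\<^esub> d)))"
    and d: "d \<in> R"
  obtains F where "finite F" "F \<subseteq> R" "\<And>a. a \<in> R \<Longrightarrow> \<exists>r\<in>F. \<exists>s\<in>R. a \<ominus>\<^bsub>K\<^esub> r = s \<otimes>\<^bsub>K\<^esub> d"
proof -
  interpret cring K by (rule K)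
  let ?coset = "\<lambda>a. {s \<otimes>\<^bsub>K\<^esub> d \<oplus>\<^bsub>K\<^esub> a | s. s \<in> R}"
  note R_carr = subsetD[OF subringE(1)[OF R]]
  \<comment> \<open>The restricted ring keeps the operations of \<open>K\<close>, so the residue
    classes are the translates of Rd by elements of R.\<close>
  have "carrier (K\<lparr>carrier := R\<rparr> Quot (PIdl\<^bsub>K\<lparr>carrier := R\<rparr>\<^esub> d)) = ?coset ` R"
    by (auto simp: FactRing_def A_RCOSETS_def' a_r_coset_def' cgenideal_def)
  then have "finite (?coset ` R)"
    using fin by simp
  then obtain F where F: "F \<subseteq> R" "finite F" "?coset ` R = ?coset ` F"
    using finite_subset_image[of "?coset ` R" ?coset R] by blast
  have "\<exists>r\<in>F. \<exists>s\<in>R. a \<ominus>\<^bsub>K\<^esub> r = s \<otimes>\<^bsub>K\<^esub> d" if a: "a \<in> R" for a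
  proof -
    obtain r where r: "r \<in> F" "?coset a = ?coset r"
      using F(3) a by (metis (no_types, lifting) imageE imageI)
    \<comment> \<open>The multiplier zero shows that a lies in its own coset, hence in that of
      r.\<close>
    have "\<zero>\<^bsub>K\<^esub> \<otimes>\<^bsub>K\<^esub> d \<oplus>\<^bsub>K\<^esub> a \<in> ?coset a"
      using subringE(2)[OF R] by blast
    then have "a \<in> ?coset r"
      using r(2) a d R_carr by simp
    then obtain s where s: "s \<in> R" "a = s \<otimes>\<^bsub>K\<^esub> d \<oplus>\<^bsub>K\<^esub> r"
      by blast
    have "s \<in> carrier K" "d \<in> carrier K" "r \<in> carrier K"
      using s r d F(1) R_carr by auto
    then have "a \<ominus>\<^bsub>K\<^esub> r = s \<otimes>\<^bsub>K\<^esub> d"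
      unfolding s(2) by algebra
    then show ?thesis
      using r s by blast
  qed
  then show thesis
    using that F by blast
qed

theorem proposition2p14:
  fixes K :: "('k, 'm) ring_scheme" and R :: "'k set"
    and B :: "('b, 'n) ring_scheme" and A :: "'b set"
  shows "(is_quotient_field R K \<and>
          (\<forall>r\<in>R - {\<zero>\<^bsub>K\<^esub>}.
             finite (carrier (K\<lparr>carrier := R\<rparr> Quot (PIdl\<^bsub>K\<lparr>carrier := R\<rparr>\<^esub> r))))
          \<longrightarrow> is_composite_cover K (int_valued_polys K R) (composite_ring K R (carrier K)))
       \<and> (cring B \<and> subring A B \<and> finite A
          \<longrightarrow> is_composite_cover B (int_valued_polys B A) (composite_ring B A (carrier B)))"
proof (intro conjI impI; elim conjE)
  assume QF: "is_quotient_field R K"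
    and fin: "\<forall>r\<in>R - {\<zero>\<^bsub>K\<^esub>}.
      finite (carrier (K\<lparr>carrier := R\<rparr> Quot (PIdl\<^bsub>K\<lparr>carrier := R\<rparr>\<^esub> r)))"
  interpret field K
    using QF by (simp add: is_quotient_field_def)
  have R: "subring R K"
    using QF by (simp add: is_quotient_field_def subdomain_def subcring_def)
  note R_carr = subsetD[OF subringE(1)[OF R]]
  show "is_composite_cover K (int_valued_polys K R) (composite_ring K R (carrier K))"
  proof (rule composite_cover_int_valued_polys[OF is_cring R])
    fix b assume b: "b \<in> carrier K"
    then obtain x d where x: "x \<in> R" and d: "d \<in> R" "d \<noteq> \<zero>\<^bsub>K\<^esub>" "b = x \<otimes>\<^bsub>K\<^esub> inv\<^bsub>K\<^esub> d"
      using QF unfolding is_quotient_field_def by blast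
    \<comment> \<open>Multiplication by \<open>d\<close> clears the denominator of \<open>b\<close>,
      so any multiple of \<open>d\<close> in R is carried into R.\<close>
    have bd: "b \<otimes>\<^bsub>K\<^esub> d = x"
      using x d R_carr by (simp add: field_Units m_assoc)
    have "finite (carrier (K\<lparr>carrier := R\<rparr> Quot (PIdl\<^bsub>K\<lparr>carrier := R\<rparr>\<^esub> d)))"
      using fin d by blast
    then obtain F where F: "finite F" "F \<subseteq> R"
      and rep: "\<And>a. a \<in> R \<Longrightarrow> \<exists>r\<in>F. \<exists>s\<in>R. a \<ominus>\<^bsub>K\<^esub> r = s \<otimes>\<^bsub>K\<^esub> d"
      using finite_quotient_representatives[OF is_cring R _ d(1)] by metis
    show "\<exists>p\<in>int_valued_polys K R. \<exists>n>0. coeff (UP K) p n = b"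
    proof (rule exists_int_valued_poly[OF is_cring R F b])
      fix a assume "a \<in> R"
      then obtain r s where rs: "r \<in> F" "s \<in> R" "a \<ominus>\<^bsub>K\<^esub> r = s \<otimes>\<^bsub>K\<^esub> d"
        using rep by blast
      have "b \<otimes>\<^bsub>K\<^esub> ((a \<ominus>\<^bsub>K\<^esub> r) \<otimes>\<^bsub>K\<^esub> c) \<in> R" if c: "c \<in> R" for c
      proof -
        have "b \<otimes>\<^bsub>K\<^esub> ((a \<ominus>\<^bsub>K\<^esub> r) \<otimes>\<^bsub>K\<^esub> c) = (b \<otimes>\<^bsub>K\<^esub> d) \<otimes>\<^bsub>K\<^esub> (s \<otimes>\<^bsub>K\<^esub> c)"
          unfolding rs(3) using b rs(2) c d(1) R_carr by (simp add: m_ac)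
        then show ?thesis
          unfolding bd using x rs(2) c subringE(6)[OF R] by simp
      qed
      then show "\<exists>r\<in>F. \<forall>c\<in>R. b \<otimes>\<^bsub>K\<^esub> ((a \<ominus>\<^bsub>K\<^esub> r) \<otimes>\<^bsub>K\<^esub> c) \<in> R"
        using rs(1) by blast
    qed
  qed
next
  assume B: "cring B" and A: "subring A B" and fin: "finite A"
  interpret cring B by (rule B)
  note A_carr = subsetD[OF subringE(1)[OF A]]
  show "is_composite_cover B (int_valued_polys B A) (composite_ring B A (carrier B))"
  proof (rule composite_cover_int_valued_polys[OF B A])
    fix b assume b: "b \<in> carrier B"
    show "\<exists>p\<in>int_valued_polys B A. \<exists>n>0. coeff (UP B) p n = b"
    \<comment> \<open>With \<open>F\<close> equal to \<open>A\<close>, the choice r = a makes one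
      factor zero, so the polynomial vanishes on all of \<open>A\<close>.\<close>
    proof (rule exists_int_valued_poly[OF B A fin subset_refl b])
      fix a assume a: "a \<in> A"
      have "b \<otimes>\<^bsub>B\<^esub> ((a \<ominus>\<^bsub>B\<^esub> a) \<otimes>\<^bsub>B\<^esub> c) \<in> A" if "c \<in> A" for c
        using a b that A_carr subringE(2)[OF A] by (simp add: minus_eq r_neg)
      then show "\<exists>r\<in>A. \<forall>c\<in>A. b \<otimes>\<^bsub>B\<^esub> ((a \<ominus>\<^bsub>B\<^esub> r) \<otimes>\<^bsub>B\<^esub> c) \<in> A"
        using a by blast
    qed
  qed
qed

end
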